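(* Let $r\ge 4$ be an integer, let $G$ be a graph with $t=\chi_{\mathrm f}(G)\ge 2$, and let $p\in(0,1)$. Suppose that for some $D\ge 0$, $$\mathbb P\bigl(\lambda_{<r}(G_p)\le D\bigr)>\frac1{2t}.$$ Then $$h_r^{\mathrm f}(G)\ge \frac{t}{(D+1)\bigl(8\log_{1/(1-p)}(2et)+4\bigr)}.$$ If, with probability greater than $1/(2t)$, the cycles of length less than $r$ in $G_p$ are pairwise vertex-disjoint, then $$h_r^{\mathrm f}(G)\ge \frac{t}{2\bigl(8\log_{1/(1-p)}(2et)+4\bigr)}.$$
   Context: All graphs are finite and simple; subgraphs need not be induced. $\chi_{\mathrm f}$ is the fractional chromatic number; $e$ in $2et$ is Euler's number. The girth of a forest is $\infty$. $G_p$ is the random spanning subgraph of $G$ obtained by retaining each edge independently with probability $p$. $h_r^{\mathrm f}(G)=\max\{\chi_{\mathrm f}(H):H\subseteq G,\ \operatorname{girth}(H)\ge r\}$. For a graph $X$, $\lambda_{<r}(X)$ is the maximum over $v\in V(X)$ of the number of cycles $C$ of $X$ with $3\le |C|<r$ and $v\in V(C)$. *)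

theory Defs
  imports "HOL-Probability.Probability" "HOL-Library.Extended_Nat"
begin

record 'a ugraph =
  verts :: "'a set"
  edges :: "'a set set"

definition simple_graph :: "'a ugraph \<Rightarrow> bool" where
  "simple_graph G \<longleftrightarrow> finite (verts G) \<and> (\<forall>e\<in>edges G. e \<subseteq> verts G \<and> card e = 2)"

definition subgraph :: "'a ugraph \<Rightarrow> 'a ugraph \<Rightarrow> bool" where
  "subgraph H G \<longleftrightarrow> simple_graph H \<and> verts H \<subseteq> verts G \<and> edges H \<subseteq> edges G"

definition independent_sets :: "'a ugraph \<Rightarrow> 'a set set" where
  "independent_sets G = {I. I \<subseteq> verts G \<and> (\<forall>e\<in>edges G. \<not> e \<subseteq> I)}"

text \<open>A fractional colouring assigns nonnegative weights to the independent sets so that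
  every vertex receives total weight at least 1.\<close>

definition fractional_coloring :: "'a ugraph \<Rightarrow> ('a set \<Rightarrow> real) \<Rightarrow> bool" where
  "fractional_coloring G w \<longleftrightarrow>
     (\<forall>I\<in>independent_sets G. 0 \<le> w I) \<and>
     (\<forall>v\<in>verts G. 1 \<le> (\<Sum>I\<in>{I \<in> independent_sets G. v \<in> I}. w I))"

definition frac_chromatic :: "'a ugraph \<Rightarrow> real" where
  "frac_chromatic G = Inf {\<Sum>I\<in>independent_sets G. w I | w. fractional_coloring G w}"

definition cycle_graph :: "'a list \<Rightarrow> 'a ugraph" where
  "cycle_graph vs =
     \<lparr>verts = set vs, edges = {{vs ! i, vs ! (Suc i mod length vs)} | i. i < length vs}\<rparr>"

text \<open>Cycles are subgraphs, so that rotating or reversing the list of vertices of a cycle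
  does not give a different cycle.  The length of a cycle is its number of vertices.\<close>

definition cycles :: "'a ugraph \<Rightarrow> 'a ugraph set" where
  "cycles X = {C. subgraph C X \<and> (\<exists>vs. distinct vs \<and> 3 \<le> length vs \<and> C = cycle_graph vs)}"

abbreviation cycle_length :: "'a ugraph \<Rightarrow> nat" where
  "cycle_length C \<equiv> card (verts C)"

text \<open>The infimum of the empty set in \<^typ>\<open>enat\<close> is \<open>\<infinity>\<close>, which is the girth of a forest.\<close>

definition girth :: "'a ugraph \<Rightarrow> enat" where
  "girth X = (INF C\<in>cycles X. enat (cycle_length C))"

definition short_cycles :: "nat \<Rightarrow> 'a ugraph \<Rightarrow> 'a ugraph set" where
  "short_cycles r X = {C \<in> cycles X. 3 \<le> cycle_length C \<and> cycle_length C < r}"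

text \<open>Both maxima below range over finite sets; the first one requires a vertex in \<open>X\<close>.\<close>

definition max_short_cycles :: "nat \<Rightarrow> 'a ugraph \<Rightarrow> nat" where
  "max_short_cycles r X = Max ((\<lambda>v. card {C \<in> short_cycles r X. v \<in> verts C}) ` verts X)"

definition h_frac :: "nat \<Rightarrow> 'a ugraph \<Rightarrow> real" where
  "h_frac r G = Max {frac_chromatic H | H. subgraph H G \<and> enat r \<le> girth H}"

definition random_subgraph :: "'a ugraph \<Rightarrow> real \<Rightarrow> 'a ugraph pmf" where
  "random_subgraph G p =
     map_pmf (\<lambda>f. \<lparr>verts = verts G, edges = {e \<in> edges G. f e}\<rparr>)
       (Pi_pmf (edges G) False (\<lambda>_. bernoulli_pmf p))"

end

theory Submission
  imports Defs
begin

text \<open>By linear programming duality there are nonnegative vertex weights \<open>w\<close> of total \<open>t / 2\<close> for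
  which every independent set of \<open>G\<close> has weight at most 1; that half of \<open>t\<close> suffices makes an
  approximate duality enough.  Put \<open>c = log (1 / (1 - p)) (2 * e * t)\<close>.  With probability at least
  \<open>1 - 1 / (2 * e * t)\<close> every independent set \<open>J\<close> of \<open>G\<^sub>p\<close> has weight at most \<open>4 * c + 2\<close>.  The
  reason is that a heavier \<open>J\<close> contains a set \<open>K\<close> of \<open>m\<close> vertices spanning at least \<open>2 * c * m\<close> edges
  of \<open>G\<close> and lying among the \<open>R * m\<close> heaviest vertices, where \<open>R = \<lfloor>t\<rfloor>\<close>.  There are at most
  \<open>(e * R) ^ m\<close> such sets, each independent in \<open>G\<^sub>p\<close> with probability at most \<open>(2 * e * t) ^ (-2 * m)\<close>.

  So some outcome \<open>X\<close> has only light independent sets and few short cycles through each vertex.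
  Colouring its vertices greedily with \<open>D + 1\<close> colours, each vertex avoiding the at most \<open>D\<close> colours
  that would complete a monochromatic short cycle, the heaviest colour class induces the
  required subgraph.  Disjoint short cycles are the case \<open>D = 1\<close>.\<close>

section \<open>Finiteness and basic facts on fractional colourings\<close>

lemma finite_subgraphs:
  assumes "simple_graph G"
  shows "finite {H. subgraph H G}"
proof -
  have fin: "finite (verts G)" and "edges G \<subseteq> Pow (verts G)"
    using assms by (auto simp: simple_graph_def)
  then have "finite (edges G)"
    by (meson finite_Pow_iff finite_subset)
  then have "finite (Pow (verts G) \<times> Pow (edges G))"
    using fin by simp
  moreover have "{H. subgraph H G} \<subseteq>
      (\<lambda>(U, E). \<lparr>verts = U, edges = E\<rparr>) ` (Pow (verts G) \<times> Pow (edges G))"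
  proof
    fix H assume "H \<in> {H. subgraph H G}"
    then have "(verts H, edges H) \<in> Pow (verts G) \<times> Pow (edges G)"
      by (auto simp: subgraph_def)
    then show "H \<in> (\<lambda>(U, E). \<lparr>verts = U, edges = E\<rparr>) ` (Pow (verts G) \<times> Pow (edges G))"
      by (rule rev_image_eqI) simp
  qed
  ultimately show ?thesis
    by (rule finite_surj)
qed

lemma finite_edges:
  assumes "simple_graph G"
  shows "finite (edges G)"
proof -
  have "edges G \<subseteq> Pow (verts G)" "finite (verts G)"
    using assms by (auto simp: simple_graph_def)
  then show ?thesis
    by (meson finite_Pow_iff finite_subset)
qed

lemma finite_independent_sets:
  assumes "simple_graph G"
  shows "finite (independent_sets G)"
proof (rule finite_subset)
  show "independent_sets G \<subseteq> Pow (verts G)"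
    by (auto simp: independent_sets_def)
  show "finite (Pow (verts G))"
    using assms by (simp add: simple_graph_def)
qed

lemma empty_independent:
  assumes "simple_graph G"
  shows "{} \<in> independent_sets G"
  using assms by (fastforce simp: simple_graph_def independent_sets_def)

lemma singleton_independent:
  assumes "simple_graph G" "v \<in> verts G"
  shows "{v} \<in> independent_sets G"
proof -
  have "\<not> e \<subseteq> {v}" if "e \<in> edges G" for e
  proof
    assume "e \<subseteq> {v}"
    then have "card e \<le> 1"
      using card_mono[of "{v}" e] by simp
    then show False
      using assms(1) that by (auto simp: simple_graph_def)
  qed
  then show ?thesis
    using assms(2) by (auto simp: independent_sets_def)
qed

lemma frac_chromatic_le:
  assumes "fractional_coloring G y"
  shows "frac_chromatic G \<le> (\<Sum>I\<in>independent_sets G. y I)"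
  unfolding frac_chromatic_def
proof (rule cInf_lower)
  show "bdd_below {\<Sum>I\<in>independent_sets G. w I |w. fractional_coloring G w}"
    by (rule bdd_belowI[of _ 0]) (auto simp: fractional_coloring_def intro!: sum_nonneg)
qed (use assms in auto)

text \<open>Ensures that the infimum defining \<open>frac_chromatic\<close> is over a nonempty set;
  singletons alone already cover every vertex.\<close>

lemma fractional_coloring_exists:
  assumes "simple_graph G"
  shows "fractional_coloring G (\<lambda>_. 1)"
  unfolding fractional_coloring_def
proof (intro conjI ballI)
  fix v assume "v \<in> verts G"
  then have "{v} \<in> {I \<in> independent_sets G. v \<in> I}"
    using singleton_independent[OF assms] by simp
  moreover have "finite {I \<in> independent_sets G. v \<in> I}"
    using finite_independent_sets[OF assms] by simp
  ultimately have "card {I \<in> independent_sets G. v \<in> I} \<noteq> 0"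
    by (metis card_0_eq empty_iff)
  then show "1 \<le> (\<Sum>I\<in>{I \<in> independent_sets G. v \<in> I}. 1::real)"
    by simp
qed simp

section \<open>Linear programming duality\<close>

lemma sum_over_covering_sets:
  fixes w :: "'a \<Rightarrow> real" and y :: "'a set \<Rightarrow> real"
  assumes "finite U" "finite \<I>" "\<And>I. I \<in> \<I> \<Longrightarrow> I \<subseteq> U"
  shows "(\<Sum>v\<in>U. w v * (\<Sum>I\<in>{I \<in> \<I>. v \<in> I}. y I)) = (\<Sum>I\<in>\<I>. y I * sum w I)"
proof -
  have "(\<Sum>v\<in>U. w v * (\<Sum>I\<in>{I \<in> \<I>. v \<in> I}. y I))
      = (\<Sum>v\<in>U. \<Sum>I\<in>\<I>. if v \<in> I then w v * y I else 0)"
    using assms(2) by (auto simp: sum_distrib_left sum.If_cases Int_def intro!: sum.cong)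
  also have "\<dots> = (\<Sum>I\<in>\<I>. \<Sum>v\<in>U. if v \<in> I then w v * y I else 0)"
    by (rule sum.swap)
  also have "\<dots> = (\<Sum>I\<in>\<I>. y I * sum w I)"
  proof (rule sum.cong)
    fix I assume "I \<in> \<I>"
    then have "U \<inter> {v. v \<in> I} = I"
      using assms(3) by auto
    then show "(\<Sum>v\<in>U. if v \<in> I then w v * y I else 0) = y I * sum w I"
      using assms(1) by (simp add: sum.If_cases sum_distrib_left mult.commute)
  qed simp
  finally show ?thesis .
qed

text \<open>Weak duality: add up the covering constraints with coefficients \<open>w v\<close> and
  count by independent sets instead of vertices. This later bounds the high-girth subgraph from
  below.\<close>

lemma frac_chromatic_ge_weight:
  fixes w :: "'a \<Rightarrow> real"
  assumes G: "simple_graph G" and "0 < K"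
    and nonneg: "\<And>v. v \<in> verts G \<Longrightarrow> 0 \<le> w v"
    and indep: "\<And>I. I \<in> independent_sets G \<Longrightarrow> sum w I \<le> K"
  shows "sum w (verts G) / K \<le> frac_chromatic G"
  unfolding frac_chromatic_def
proof (rule cInf_greatest)
  show "{\<Sum>I\<in>independent_sets G. y I |y. fractional_coloring G y} \<noteq> {}"
    using fractional_coloring_exists[OF G] by auto
next
  fix x assume "x \<in> {\<Sum>I\<in>independent_sets G. y I |y. fractional_coloring G y}"
  then obtain y where y: "fractional_coloring G y" and x: "x = (\<Sum>I\<in>independent_sets G. y I)"
    by auto
  have "sum w (verts G) \<le> (\<Sum>v\<in>verts G. w v * (\<Sum>I\<in>{I \<in> independent_sets G. v \<in> I}. y I))"
  proof (rule sum_mono)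
    fix v assume v: "v \<in> verts G"
    then have "1 \<le> (\<Sum>I\<in>{I \<in> independent_sets G. v \<in> I}. y I)"
      using y by (simp add: fractional_coloring_def)
    then show "w v \<le> w v * (\<Sum>I\<in>{I \<in> independent_sets G. v \<in> I}. y I)"
      using mult_left_mono[OF _ nonneg[OF v]] by fastforce
  qed
  also have "\<dots> = (\<Sum>I\<in>independent_sets G. y I * sum w I)"
    using G finite_independent_sets[OF G]
    by (intro sum_over_covering_sets) (auto simp: simple_graph_def independent_sets_def)
  also have "\<dots> \<le> (\<Sum>I\<in>independent_sets G. y I * K)"
    using y indep by (intro sum_mono mult_left_mono) (auto simp: fractional_coloring_def)
  also have "\<dots> = x * K"
    by (simp add: x sum_distrib_right)
  finally show "sum w (verts G) / K \<le> x"
    using \<open>0 < K\<close> by (simp add: divide_le_eq)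
qed

text \<open>Otherwise the least coverage \<open>m\<close> exceeds
  \<open>1 / frac_chromatic G\<close>, and dividing \<open>l\<close> by \<open>m\<close> gives a
  fractional colouring of total \<open>1 / m\<close>, which is too cheap.\<close>

lemma distribution_undercovers_vertex:
  fixes l :: "'a set \<Rightarrow> real"
  assumes G: "simple_graph G" and pos: "0 < frac_chromatic G"
    and nonneg: "\<And>I. I \<in> independent_sets G \<Longrightarrow> 0 \<le> l I"
    and total: "sum l (independent_sets G) = 1"
  shows "\<exists>v\<in>verts G. (\<Sum>I\<in>{I \<in> independent_sets G. v \<in> I}. l I) \<le> 1 / frac_chromatic G"
proof (rule ccontr)
  define cov where "cov v = (\<Sum>I\<in>{I \<in> independent_sets G. v \<in> I}. l I)" for v
  assume "\<not> ?thesis"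
  then have gt: "1 / frac_chromatic G < cov v" if "v \<in> verts G" for v
    using that by (auto simp: cov_def not_le)
  have "verts G \<noteq> {}"
  proof
    assume "verts G = {}"
    then have "fractional_coloring G (\<lambda>_. 0)"
      by (simp add: fractional_coloring_def)
    from frac_chromatic_le[OF this] pos show False
      by simp
  qed
  moreover have fin: "finite (verts G)"
    using G by (simp add: simple_graph_def)
  moreover define m where "m = Min (cov ` verts G)"
  ultimately have m: "1 / frac_chromatic G < m"
    using gt by simp
  have m_pos: "0 < m"
    using m pos by (meson less_trans zero_less_divide_1_iff)
  have "fractional_coloring G (\<lambda>I. l I / m)"
    unfolding fractional_coloring_def
  proof (intro conjI ballI)
    fix v assume "v \<in> verts G"
    then have "m \<le> cov v"
      using fin by (simp add: m_def)
    then show "1 \<le> (\<Sum>I\<in>{I \<in> independent_sets G. v \<in> I}. l I / m)"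
      using m_pos by (simp add: cov_def flip: sum_divide_distrib)
  qed (use nonneg m_pos in simp)
  from frac_chromatic_le[OF this] have "frac_chromatic G \<le> 1 / m"
    by (simp add: total flip: sum_divide_distrib)
  with m m_pos pos show False
    by (simp add: field_simps)
qed

text \<open>An approximate form of linear programming duality.  For a probability distribution \<open>l\<close> on the
  independent sets let \<open>w v\<close> be the amount by which \<open>v\<close> fails to be covered with probability \<open>1 / s\<close>.
  If \<open>l\<close> nearly minimises the sum of the squares of \<open>w\<close>, then moving \<open>l\<close> towards any independent
  set cannot decrease this sum much, and this first-order condition bounds the \<open>w\<close>-weight of that
  set.\<close>

lemma fractional_clique_exists:
  fixes s :: real
  assumes G: "simple_graph G" and "0 < s" and "s < frac_chromatic G"
  obtains w :: "'a \<Rightarrow> real" where "\<And>v. 0 \<le> w v" "sum w (verts G) = s"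
    "\<And>I. I \<in> independent_sets G \<Longrightarrow> sum w I \<le> 1"
proof -
  define V where "V = verts G"
  define \<I> where "\<I> = independent_sets G"
  define t where "t = frac_chromatic G"
  define dist where "dist l \<longleftrightarrow> (\<forall>I\<in>\<I>. 0 \<le> l I) \<and> sum l \<I> = 1" for l :: "'a set \<Rightarrow> real"
  define cov where "cov l v = (\<Sum>I\<in>{I \<in> \<I>. v \<in> I}. l I)" for l :: "'a set \<Rightarrow> real" and v
  define w where "w l v = max 0 (1 / s - cov l v)" for l v
  define F where "F l = (\<Sum>v\<in>V. (w l v)\<^sup>2)" for l
  \<comment> \<open>Every distribution leaves some vertex with deficiency at least
    \<open>1 / s - 1 / t\<close>, so its square is a lower bound for \<open>F\<close>.\<close>
  define \<epsilon> where "\<epsilon> = (1 / s - 1 / t)\<^sup>2"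
  \<comment> \<open>Step length of the perturbation, small enough that the quadratic terms, in total
    at most \<open>\<eta>\<^sup>2 * card V\<close>, stay below \<open>\<eta> * \<epsilon>\<close>.
    The summand 1 guards against division by zero.\<close>
  define \<eta> where "\<eta> = min 1 (\<epsilon> / (card V + 1))"
  have finV: "finite V" and fin: "finite \<I>" and sub: "\<And>I. I \<in> \<I> \<Longrightarrow> I \<subseteq> V"
    using G finite_independent_sets[OF G]
    by (auto simp: V_def \<I>_def simple_graph_def independent_sets_def)
  have gap: "0 < 1 / s - 1 / t"
    using assms by (simp add: t_def frac_less2)
  then have eps: "0 < \<epsilon>"
    unfolding \<epsilon>_def by (rule zero_less_power)
  then have eta: "0 < \<eta>" "\<eta> \<le> 1" "\<eta> * card V \<le> \<epsilon>"
  proof -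
    show "0 < \<eta>" "\<eta> \<le> 1"
      using eps by (auto simp: \<eta>_def)
    have "\<eta> * card V \<le> \<epsilon> / (card V + 1) * card V"
      by (intro mult_right_mono) (auto simp: \<eta>_def)
    also have "\<dots> \<le> \<epsilon>"
      using eps by (simp add: field_simps)
    finally show "\<eta> * card V \<le> \<epsilon>" .
  qed
  have deficient: "\<exists>v\<in>V. 1 / s - 1 / t \<le> w l v" if "dist l" for l
  proof -
    have "\<exists>v\<in>V. cov l v \<le> 1 / t"
      using distribution_undercovers_vertex[OF G, of l] that assms
      by (auto simp: dist_def cov_def V_def \<I>_def t_def)
    then show ?thesis
      by (force simp: w_def)
  qed
  have F_ge: "\<epsilon> \<le> F l" if l: "dist l" for l
  proof -
    obtain v where v: "v \<in> V" "1 / s - 1 / t \<le> w l v"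
      using deficient[OF l] by blast
    then have "\<epsilon> \<le> (w l v)\<^sup>2"
      using gap by (simp add: \<epsilon>_def power_mono)
    also have "\<dots> \<le> F l"
      unfolding F_def using v finV by (intro member_le_sum) auto
    finally show ?thesis .
  qed
  have "dist (\<lambda>I. if I = {} then 1 else 0)"
    using fin empty_independent[OF G] by (simp add: dist_def \<I>_def)
  then have ne: "F ` {l. dist l} \<noteq> {}"
    by blast
  have bdd: "bdd_below (F ` {l. dist l})"
    using F_ge by (intro bdd_belowI[of _ \<epsilon>]) auto
  \<comment> \<open>A minimiser up to \<open>\<eta> * \<epsilon>\<close> is enough, so no
    compactness argument is needed.\<close>
  have "\<exists>x\<in>F ` {l. dist l}. x < Inf (F ` {l. dist l}) + \<eta> * \<epsilon>"
    using eta eps by (intro cInf_lessD ne) simp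
  then obtain l where l: "dist l" and "F l < Inf (F ` {l. dist l}) + \<eta> * \<epsilon>"
    by auto
  then have near: "F l < F l' + \<eta> * \<epsilon>" if "dist l'" for l'
    using cInf_lower[OF _ bdd, of "F l'"] that by fastforce
  define W where "W = sum (w l) V"
  have key: "sum (w l) I \<le> W / s" if I: "I \<in> \<I>" for I
  proof -
    \<comment> \<open>The rate at which the coverage of \<open>v\<close> changes when
      \<open>l\<close> moves towards the point mass at \<open>I\<close>.\<close>
    define y where "y v = of_bool (v \<in> I) - cov l v" for v
    define l' where "l' K = (1 - \<eta>) * l K + \<eta> * of_bool (K = I)" for K
    have "dist l'"
      using l I fin eta
      by (auto simp: dist_def l'_def sum.distrib simp flip: sum_distrib_left)
    have cov': "cov l' v = cov l v + \<eta> * y v" for v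
    proof -
      have "(\<Sum>K\<in>{K \<in> \<I>. v \<in> K}. of_bool (K = I)) = (of_bool (v \<in> I) :: real)"
        using I fin by (simp add: of_bool_def)
      then have "cov l' v = (1 - \<eta>) * cov l v + \<eta> * of_bool (v \<in> I)"
        by (simp only: cov_def l'_def sum.distrib flip: sum_distrib_left)
      then show ?thesis
        by (simp add: y_def algebra_simps)
    qed
    have "\<bar>y v\<bar> \<le> 1" for v
    proof -
      have "0 \<le> cov l v"
        using l by (auto simp: cov_def dist_def intro: sum_nonneg)
      moreover have "cov l v \<le> sum l \<I>"
        unfolding cov_def using l fin by (intro sum_mono2) (auto simp: dist_def)
      ultimately show ?thesis
        using l by (auto simp: y_def dist_def)
    qed
    then have y_sq: "(y v)\<^sup>2 \<le> 1" for v
      by (simp add: abs_square_le_1)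
    \<comment> \<open>Clipping at 0 only helps: if \<open>v\<close> is covered in excess, then
      \<open>w l v = 0\<close> and the excess absorbs part of the change.\<close>
    have "(w l' v)\<^sup>2 \<le> (w l v - \<eta> * y v)\<^sup>2" for v
    proof (cases "0 \<le> 1 / s - cov l v")
      case True
      then have "w l' v = max 0 (w l v - \<eta> * y v)"
        by (simp add: w_def cov' algebra_simps)
      then show ?thesis
        by (auto simp: max_def)
    next
      case False
      then have "w l v = 0" "\<bar>w l' v\<bar> \<le> \<bar>\<eta> * y v\<bar>"
        by (auto simp: w_def cov')
      then show ?thesis
        by (simp add: abs_le_square_iff)
    qed
    also have "(w l v - \<eta> * y v)\<^sup>2 \<le> (w l v)\<^sup>2 - 2 * \<eta> * (w l v * y v) + \<eta>\<^sup>2" for v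
      using mult_left_mono[OF y_sq[of v], of "\<eta>\<^sup>2"] by (simp add: power2_eq_square algebra_simps)
    finally have "F l' \<le> (\<Sum>v\<in>V. (w l v)\<^sup>2 - 2 * \<eta> * (w l v * y v) + \<eta>\<^sup>2)"
      unfolding F_def by (intro sum_mono)
    also have "\<dots> = F l - 2 * \<eta> * (\<Sum>v\<in>V. w l v * y v) + \<eta> * (\<eta> * card V)"
      by (simp add: F_def sum.distrib sum_subtractf power2_eq_square flip: sum_distrib_left)
    also have "\<eta> * (\<eta> * card V) \<le> \<eta> * \<epsilon>"
      using eta by (intro mult_left_mono) auto
    \<comment> \<open>Near-minimality and the quadratic terms each contribute
      \<open>\<eta> * \<epsilon>\<close>, which cancels the factor 2 of the linear term.\<close>
    finally have "\<eta> * (\<Sum>v\<in>V. w l v * y v) < \<eta> * \<epsilon>"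
      using near[OF \<open>dist l'\<close>] by linarith
    then have first_order: "(\<Sum>v\<in>V. w l v * y v) < \<epsilon>"
      using eta by simp
    \<comment> \<open>Where \<open>w l v\<close> is positive,
      \<open>cov l v = 1 / s - w l v\<close>; elsewhere both summands vanish. The squares add up to
      \<open>F l \<ge> \<epsilon>\<close>, which outweighs the error in
      \<open>first_order\<close>.\<close>
    have "(\<Sum>v\<in>V. w l v * y v) = (\<Sum>v\<in>V. w l v * of_bool (v \<in> I) - w l v / s + (w l v)\<^sup>2)"
      using \<open>0 < s\<close>
      by (intro sum.cong) (auto simp: y_def w_def max_def power2_eq_square field_simps)
    also have "\<dots> = (\<Sum>v\<in>V. w l v * of_bool (v \<in> I)) - W / s + F l"
      by (simp add: sum.distrib sum_subtractf F_def W_def flip: sum_divide_distrib)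
    also have "(\<Sum>v\<in>V. w l v * of_bool (v \<in> I)) = sum (w l) I"
      using sub[OF I] finV by (simp add: of_bool_def sum.If_cases Int_absorb1 if_distrib cong: if_cong)
    finally show ?thesis
      using first_order F_ge[OF l] by linarith
  qed
  have "0 < W"
  proof -
    obtain v where "v \<in> V" "0 < w l v"
      using deficient[OF l] gap by fastforce
    then show ?thesis
      unfolding W_def using finV by (intro sum_pos2[of V v]) (auto simp: w_def)
  qed
  show thesis
  proof (rule that)
    show "0 \<le> s * w l v / W" for v
      using \<open>0 < W\<close> \<open>0 < s\<close> by (simp add: w_def)
    show "(\<Sum>v\<in>verts G. s * w l v / W) = s"
      using \<open>0 < W\<close> by (simp add: W_def V_def flip: sum_divide_distrib sum_distrib_left)
    show "(\<Sum>v\<in>I. s * w l v / W) \<le> 1" if "I \<in> independent_sets G" for I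
      using key[of I] that \<open>0 < W\<close> \<open>0 < s\<close>
      by (simp add: \<I>_def field_simps flip: sum_divide_distrib sum_distrib_left)
  qed
qed


section \<open>Greedy colouring and dense subsets of heavy sets\<close>

text \<open>Pick one vertex other than \<open>v\<close> from each edge and avoid the colours of
  these at most \<open>d\<close> vertices; \<open>d + 1\<close> colours are available.\<close>

lemma nonmonochromatic_extension:
  fixes f :: "'a \<Rightarrow> nat"
  assumes "finite \<E>" "card \<E> \<le> d" "\<And>e. e \<in> \<E> \<Longrightarrow> \<not> e \<subseteq> {v}"
  shows "\<exists>c\<le>d. \<forall>e\<in>\<E>. \<exists>u\<in>e. u \<noteq> v \<and> f u \<noteq> c"
proof -
  have "\<forall>e\<in>\<E>. \<exists>u. u \<in> e \<and> u \<noteq> v"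
    using assms(3) by blast
  then obtain g where g: "\<forall>e\<in>\<E>. g e \<in> e \<and> g e \<noteq> v"
    by metis
  have "card ((\<lambda>e. f (g e)) ` \<E>) \<le> d"
    using card_image_le[OF assms(1)] assms(2) le_trans by blast
  then have "\<not> {..d} \<subseteq> (\<lambda>e. f (g e)) ` \<E>"
    using card_mono[of "(\<lambda>e. f (g e)) ` \<E>" "{..d}"] assms(1) by auto
  then obtain c where "c \<le> d" "c \<notin> (\<lambda>e. f (g e)) ` \<E>"
    by auto
  with g show ?thesis
    by (intro exI[of _ c]) blast
qed

text \<open>Vertices are coloured one at a time. An edge matters only when its last vertex is
  reached, hence the restriction to edges inside \<open>V\<close>, on which the induction
  runs.\<close>

lemma hypergraph_coloring:
  fixes \<E> :: "'a set set"
  assumes "finite V" "\<And>e v. e \<in> \<E> \<Longrightarrow> \<not> e \<subseteq> {v}"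
    and "\<And>v. v \<in> V \<Longrightarrow> finite {e \<in> \<E>. v \<in> e} \<and> card {e \<in> \<E>. v \<in> e} \<le> d"
  shows "\<exists>f::'a \<Rightarrow> nat. (\<forall>v. f v \<le> d) \<and> (\<forall>e\<in>\<E>. e \<subseteq> V \<longrightarrow> \<not> (\<exists>c. f ` e \<subseteq> {c}))"
  using assms(1,3)
proof (induction V)
  case empty
  show ?case
    using assms(2) by (intro exI[of _ "\<lambda>_. 0"]) auto
next
  case (insert v V)
  then obtain f :: "'a \<Rightarrow> nat" where f: "\<forall>v. f v \<le> d"
    "\<forall>e\<in>\<E>. e \<subseteq> V \<longrightarrow> \<not> (\<exists>c. f ` e \<subseteq> {c})"
    by auto
  have "\<exists>c\<le>d. \<forall>e\<in>{e \<in> \<E>. v \<in> e}. \<exists>u\<in>e. u \<noteq> v \<and> f u \<noteq> c"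
    using insert.prems[of v] assms(2) by (intro nonmonochromatic_extension) auto
  then obtain c where c: "c \<le> d" "\<And>e. e \<in> \<E> \<Longrightarrow> v \<in> e \<Longrightarrow> \<exists>u\<in>e. u \<noteq> v \<and> f u \<noteq> c"
    by blast
  have "\<not> (\<exists>a. (f(v := c)) ` e \<subseteq> {a})" if e: "e \<in> \<E>" "e \<subseteq> insert v V" for e
  proof (cases "v \<in> e")
    case True
    then obtain u where "u \<in> e" "u \<noteq> v" "f u \<noteq> c"
      using c e by blast
    with True show ?thesis
      by (auto simp: image_subset_iff)
  next
    case False
    then have "(f(v := c)) ` e = f ` e" "e \<subseteq> V"
      using e by auto
    then show ?thesis
      using f(2) e(1) by simp
  qed
  then show ?case
    using f(1) c(1) by (intro exI[of _ "f(v := c)"]) auto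
qed

text \<open>A set without dense subsets of heavy vertices is dismantled by removing one vertex at a time.
  A vertex of small degree goes to \<open>A\<close>, which stays colourable with few colours; a vertex \<open>v\<close>
  whose rank \<open>\<rho> v\<close> (rank 0 being the heaviest) is large compared to the current size goes to
  \<open>B\<close>, and its weight is paid for by \<open>R\<close> heavier vertices of consecutive ranks.\<close>

lemma peeling:
  fixes w :: "'a \<Rightarrow> real" and \<rho> :: "'a \<Rightarrow> nat"
  assumes V: "finite V" and rank: "bij_betw \<rho> V {..<n}"
    and antimono: "\<And>u v. u \<in> V \<Longrightarrow> v \<in> V \<Longrightarrow> \<rho> u \<le> \<rho> v \<Longrightarrow> w v \<le> w u"
    and E: "finite E" "\<And>e v. e \<in> E \<Longrightarrow> \<not> e \<subseteq> {v}"
    and J: "J \<subseteq> V"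
    and sparse: "\<And>K. K \<subseteq> J \<Longrightarrow> K \<noteq> {} \<Longrightarrow> (\<forall>v\<in>K. \<rho> v < R * card K)
      \<Longrightarrow> \<exists>v\<in>K. card {e \<in> E. e \<subseteq> K \<and> v \<in> e} \<le> d"
  shows "\<exists>A B. \<exists>f::'a \<Rightarrow> nat. A \<union> B = J \<and> A \<inter> B = {} \<and> (\<forall>v. f v \<le> d) \<and>
    (\<forall>e\<in>E. e \<subseteq> A \<longrightarrow> \<not> (\<exists>c. f ` e \<subseteq> {c})) \<and>
    R * sum w B \<le> sum w {u \<in> V. \<rho> u < R * card B}"
proof -
  have "finite J"
    using J V by (rule finite_subset)
  then show ?thesis
    using J sparse
  proof (induction J rule: finite_psubset_induct)
    case (psubset J)
    show ?case
    proof (cases "J = {}")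
      case True
      then show ?thesis
        using E(2) by (intro exI[of _ "{}"] exI[of _ "\<lambda>_. 0"]) auto
    next
      case nonempty: False
      have IH: "\<exists>A B. \<exists>f::'a \<Rightarrow> nat. A \<union> B = J - {v} \<and> A \<inter> B = {} \<and> (\<forall>v. f v \<le> d) \<and>
          (\<forall>e\<in>E. e \<subseteq> A \<longrightarrow> \<not> (\<exists>c. f ` e \<subseteq> {c})) \<and>
          R * sum w B \<le> sum w {u \<in> V. \<rho> u < R * card B}" if "v \<in> J" for v
      proof (rule psubset.IH)
        show "J - {v} \<subset> J"
          using that by blast
        show "J - {v} \<subseteq> V"
          using psubset.prems(1) by blast
        show "\<exists>v\<in>K. card {e \<in> E. e \<subseteq> K \<and> v \<in> e} \<le> d"
          if "K \<subseteq> J - {v}" "K \<noteq> {}" "\<forall>v\<in>K. \<rho> v < R * card K" for K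
          using psubset.prems(2)[of K] that by blast
      qed
      show ?thesis
      \<comment> \<open>If all ranks in \<open>J\<close> are small, \<open>sparse\<close> applies to
        \<open>J\<close> itself and yields a vertex for \<open>A\<close>; otherwise a vertex of
        large rank goes to \<open>B\<close>.\<close>
      proof (cases "\<forall>v\<in>J. \<rho> v < R * card J")
        case True
        then obtain v where v: "v \<in> J" "card {e \<in> E. e \<subseteq> J \<and> v \<in> e} \<le> d"
          using psubset.prems(2)[of J] nonempty by blast
        obtain A B and f :: "'a \<Rightarrow> nat" where ABf: "A \<union> B = J - {v}" "A \<inter> B = {}" "\<forall>v. f v \<le> d"
          "\<forall>e\<in>E. e \<subseteq> A \<longrightarrow> \<not> (\<exists>c. f ` e \<subseteq> {c})"
          "R * sum w B \<le> sum w {u \<in> V. \<rho> u < R * card B}"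
          using IH[OF v(1)] by (elim exE conjE) (rule that)
        obtain c where c: "c \<le> d"
          "\<And>e. e \<in> E \<Longrightarrow> e \<subseteq> J \<Longrightarrow> v \<in> e \<Longrightarrow> \<exists>u\<in>e. u \<noteq> v \<and> f u \<noteq> c"
          using nonmonochromatic_extension[of "{e \<in> E. e \<subseteq> J \<and> v \<in> e}" d v f] v(2) E by auto
        have "\<not> (\<exists>a. (f(v := c)) ` e \<subseteq> {a})" if e: "e \<in> E" "e \<subseteq> insert v A" for e
        proof (cases "v \<in> e")
          case True
          have "e \<subseteq> J"
            using e ABf(1) v(1) by blast
          then obtain u where "u \<in> e" "u \<noteq> v" "f u \<noteq> c"
            using c e True by blast
          with True show ?thesis
            by (auto simp: image_subset_iff)
        next
          case False
          then have "(f(v := c)) ` e = f ` e" "e \<subseteq> A"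
            using e by auto
          then show ?thesis
            using ABf(4) e(1) by simp
        qed
        moreover have "insert v A \<union> B = J" "insert v A \<inter> B = {}"
          using ABf(1,2) v(1) by auto
        ultimately show ?thesis
          using ABf(3,5) c(1)
          by (intro exI[of _ "insert v A"] exI[of _ B] exI[of _ "f(v := c)"]) auto
      next
        case False
        then obtain v where v: "v \<in> J" "R * card J \<le> \<rho> v"
          by (auto simp: not_less)
        obtain A B and f :: "'a \<Rightarrow> nat" where ABf: "A \<union> B = J - {v}" "A \<inter> B = {}" "\<forall>v. f v \<le> d"
          "\<forall>e\<in>E. e \<subseteq> A \<longrightarrow> \<not> (\<exists>c. f ` e \<subseteq> {c})"
          "R * sum w B \<le> sum w {u \<in> V. \<rho> u < R * card B}"
          using IH[OF v(1)] by (elim exE conjE) (rule that)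
        have vB: "v \<notin> B" and "insert v B \<subseteq> J"
          using ABf(1) v(1) by auto
        moreover from this have "finite B"
          using psubset.hyps by (meson finite_insert finite_subset)
        ultimately have card_B: "card (insert v B) = Suc (card B)"
          by simp
        have vV: "v \<in> V"
          using v(1) psubset.prems(1) by blast
        have "card (insert v B) \<le> card J"
          using psubset.hyps \<open>insert v B \<subseteq> J\<close> by (intro card_mono)
        then have "R * Suc (card B) \<le> R * card J"
          unfolding card_B by (rule mult_le_mono2)
        then have end_le: "R * Suc (card B) \<le> \<rho> v"
          using v(2) by linarith
        \<comment> \<open>The next \<open>R\<close> ranks after those already charged to
          \<open>B\<close>. By \<open>end_le\<close> they all precede \<open>\<rho> v\<close>, so
          each vertex of \<open>Q\<close> weighs at least \<open>w v\<close>. The charged vertices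
          need not lie in \<open>J\<close>.\<close>
        define Q where "Q = {u \<in> V. R * card B \<le> \<rho> u \<and> \<rho> u < R * Suc (card B)}"
        have "\<rho> ` Q = {R * card B..<R * Suc (card B)}"
        proof
          show "{R * card B..<R * Suc (card B)} \<subseteq> \<rho> ` Q"
          proof
            fix k assume k: "k \<in> {R * card B..<R * Suc (card B)}"
            have "\<rho> v < n"
              using rank vV bij_betwE by blast
            then have "k \<in> \<rho> ` V"
              using k end_le rank by (auto simp: bij_betw_def)
            then show "k \<in> \<rho> ` Q"
              using k by (auto simp: Q_def)
          qed
        qed (auto simp: Q_def)
        moreover have "inj_on \<rho> Q"
          using rank by (auto simp: bij_betw_def Q_def inj_on_def)
        ultimately have "card Q = R"
          using card_image[of \<rho> Q] by simp
        then have "R * w v = (\<Sum>u\<in>Q. w v)"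
          by simp
        also have "\<dots> \<le> sum w Q"
          using end_le vV by (intro sum_mono antimono) (auto simp: Q_def)
        finally have "R * sum w (insert v B) \<le> sum w {u \<in> V. \<rho> u < R * card B} + sum w Q"
          using ABf(5) \<open>finite B\<close> vB by (simp add: distrib_left)
        also have "\<dots> = sum w ({u \<in> V. \<rho> u < R * card B} \<union> Q)"
          using V by (intro sum.union_disjoint[symmetric]) (auto simp: Q_def)
        also have "{u \<in> V. \<rho> u < R * card B} \<union> Q = {u \<in> V. \<rho> u < R * card (insert v B)}"
          by (auto simp: Q_def card_B)
        finally have weight: "R * sum w (insert v B)
          \<le> sum w {u \<in> V. \<rho> u < R * card (insert v B)}" .
        have "v \<notin> A" "A \<union> insert v B = J" "A \<inter> insert v B = {}"
          using ABf(1,2) v(1) by auto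
        with ABf(3,4) weight show ?thesis
          by - (rule exI[of _ A], rule exI[of _ "insert v B"], rule exI[of _ f], intro conjI)
      qed
    qed
  qed
qed

text \<open>Without a suitable \<open>K\<close> of minimum degree above \<open>d\<close>, peeling
  splits \<open>J\<close> into \<open>A\<close>, a union of \<open>d + 1\<close> independent sets of
  weight at most 1 each, and \<open>B\<close>, of weight at most \<open>sum w (verts G) / R\<close>.
  This contradicts \<open>heavy\<close>; the edge count for \<open>K\<close> is then the handshake
  identity.\<close>

lemma dense_subset_of_heavy_set:
  fixes w :: "'a \<Rightarrow> real" and \<rho> :: "'a \<Rightarrow> nat"
  assumes G: "simple_graph G" and rank: "bij_betw \<rho> (verts G) {..<n}"
    and antimono: "\<And>u v. u \<in> verts G \<Longrightarrow> v \<in> verts G \<Longrightarrow> \<rho> u \<le> \<rho> v \<Longrightarrow> w v \<le> w u"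
    and nonneg: "\<And>v. v \<in> verts G \<Longrightarrow> 0 \<le> w v"
    and indep: "\<And>I. I \<in> independent_sets G \<Longrightarrow> sum w I \<le> 1"
    and "0 < R" and J: "J \<subseteq> verts G" and heavy: "d + 1 + sum w (verts G) / R < sum w J"
  shows "\<exists>K\<subseteq>J. K \<noteq> {} \<and> (\<forall>v\<in>K. \<rho> v < R * card K) \<and>
    (d + 1) * card K \<le> 2 * card {e \<in> edges G. e \<subseteq> K}"
proof -
  have V: "finite (verts G)" and E: "finite (edges G)" "\<And>e. e \<in> edges G \<Longrightarrow> card e = 2"
    using G finite_edges[OF G] by (auto simp: simple_graph_def)
  have nonsingle: "\<not> e \<subseteq> {v}" if "e \<in> edges G" for e v
    using E(2)[OF that] card_mono[of "{v}" e] by auto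
  have "\<exists>K\<subseteq>J. K \<noteq> {} \<and> (\<forall>v\<in>K. \<rho> v < R * card K) \<and>
    (\<forall>v\<in>K. d < card {e \<in> edges G. e \<subseteq> K \<and> v \<in> e})"
  proof (rule ccontr)
    assume none: "\<not> ?thesis"
    have "\<exists>A B. \<exists>f::'a \<Rightarrow> nat. A \<union> B = J \<and> A \<inter> B = {} \<and> (\<forall>v. f v \<le> d) \<and>
      (\<forall>e\<in>edges G. e \<subseteq> A \<longrightarrow> \<not> (\<exists>c. f ` e \<subseteq> {c})) \<and>
      R * sum w B \<le> sum w {u \<in> verts G. \<rho> u < R * card B}"
    proof (intro peeling[OF V rank antimono E(1) nonsingle J])
      show "\<exists>v\<in>K. card {e \<in> edges G. e \<subseteq> K \<and> v \<in> e} \<le> d"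
        if "K \<subseteq> J" "K \<noteq> {}" "\<forall>v\<in>K. \<rho> v < R * card K" for K
        using none that by (meson not_less)
    qed
    then obtain A B and f :: "'a \<Rightarrow> nat" where ABf: "A \<union> B = J" "A \<inter> B = {}" "\<forall>v. f v \<le> d"
      "\<forall>e\<in>edges G. e \<subseteq> A \<longrightarrow> \<not> (\<exists>c. f ` e \<subseteq> {c})"
      "R * sum w B \<le> sum w {u \<in> verts G. \<rho> u < R * card B}"
      by blast
    have finAB: "finite A" "finite B"
      using finite_subset[OF J V] ABf(1) by (metis finite_Un)+
    have "sum w {u \<in> verts G. \<rho> u < R * card B} \<le> sum w (verts G)"
      using V nonneg by (intro sum_mono2) auto
    then have B: "sum w B \<le> sum w (verts G) / R"
      using ABf(5) \<open>0 < R\<close> by (simp add: field_simps)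
    have "sum w A = (\<Sum>c\<in>{..d}. sum w {v \<in> A. f v = c})"
      using ABf(3) finAB by (intro sum.group[symmetric]) auto
    also have "\<dots> \<le> (\<Sum>c\<in>{..d}. 1)"
    proof (rule sum_mono, rule indep)
      fix c
      have "\<not> e \<subseteq> {v \<in> A. f v = c}" if e: "e \<in> edges G" for e
      proof
        assume "e \<subseteq> {v \<in> A. f v = c}"
        then have "e \<subseteq> A" "f ` e \<subseteq> {c}"
          by auto
        then show False
          using ABf(4) e by blast
      qed
      then show "{v \<in> A. f v = c} \<in> independent_sets G"
        using ABf(1) J by (auto simp: independent_sets_def)
    qed
    also have "\<dots> = d + 1"
      by simp
    finally have "sum w J \<le> d + 1 + sum w (verts G) / R"
      using B ABf(1,2) finAB sum.union_disjoint[of A B w] by simp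
    then show False
      using heavy by simp
  qed
  then obtain K where K: "K \<subseteq> J" "K \<noteq> {}" "\<forall>v\<in>K. \<rho> v < R * card K"
    "\<forall>v\<in>K. d < card {e \<in> edges G. e \<subseteq> K \<and> v \<in> e}"
    by blast
  have finK: "finite K"
    using K(1) J V by (meson finite_subset)
  have "(d + 1) * card K = (\<Sum>v\<in>K. d + 1)"
    by simp
  also have "\<dots> \<le> (\<Sum>v\<in>K. card {e \<in> {e \<in> edges G. e \<subseteq> K}. v \<in> e})"
    using K(4) by (intro sum_mono) (simp add: Suc_le_eq conj_assoc)
  also have "\<dots> = 2 * card {e \<in> edges G. e \<subseteq> K}"
  proof (rule sum_multicount)
    show "\<forall>e\<in>{e \<in> edges G. e \<subseteq> K}. card {v \<in> K. v \<in> e} = 2"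
    proof
      fix e assume e: "e \<in> {e \<in> edges G. e \<subseteq> K}"
      then have "{v \<in> K. v \<in> e} = e"
        by auto
      then show "card {v \<in> K. v \<in> e} = 2"
        using E(2) e by simp
    qed
  qed (use finK E in auto)
  finally show ?thesis
    using K(1-3) by blast
qed


section \<open>Union bound over dense sets of heavy vertices\<close>

text \<open>Sorting breaks ties, so that fewer than \<open>N + 1\<close> vertices have rank below
  \<open>N\<close> even if many weights coincide.\<close>

lemma rank_by_weight:
  fixes w :: "'a \<Rightarrow> real"
  assumes "finite V"
  obtains \<rho> :: "'a \<Rightarrow> nat" where "bij_betw \<rho> V {..<card V}"
    "\<And>u v. u \<in> V \<Longrightarrow> v \<in> V \<Longrightarrow> \<rho> u \<le> \<rho> v \<Longrightarrow> w v \<le> w u"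
proof -
  obtain ys where ys: "set ys = V" "distinct ys"
    using finite_distinct_list[OF assms] by blast
  define xs where "xs = sort_key (\<lambda>v. - w v) ys"
  have xs: "set xs = V" "distinct xs" "length xs = card V" "sorted (map (\<lambda>v. - w v) xs)"
    using ys by (auto simp: xs_def simp flip: distinct_card)
  define \<rho> where "\<rho> = the_inv_into {..<card V} ((!) xs)"
  have nth: "bij_betw ((!) xs) {..<card V} V"
    using xs by (intro bij_betw_nth) auto
  show thesis
  proof (rule that)
    show "bij_betw \<rho> V {..<card V}"
      unfolding \<rho>_def by (rule bij_betw_the_inv_into[OF nth])
    then have lt: "\<rho> v < card V" if "v \<in> V" for v
      using that bij_betwE by blast
    have inv: "xs ! \<rho> v = v" if "v \<in> V" for v
      unfolding \<rho>_def using that nth by (intro f_the_inv_into_f) (auto simp: bij_betw_def)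
    show "w v \<le> w u" if "u \<in> V" "v \<in> V" "\<rho> u \<le> \<rho> v" for u v
      using sorted_nth_mono[OF xs(4) that(3)] lt inv that xs(3) by simp
  qed
qed

lemma power_div_fact_le_exp:
  fixes x :: real
  assumes "0 \<le> x"
  shows "x ^ n / fact n \<le> exp x"
proof -
  have "(\<lambda>n. x ^ n / fact n) sums exp x"
    using exp_converges[of x] by (simp add: field_simps)
  moreover from this have "(\<Sum>n\<in>{n}. x ^ n / fact n) \<le> (\<Sum>n. x ^ n / fact n)"
    using assms by (intro sum_le_suminf) (auto simp: sums_iff)
  ultimately have "(\<Sum>n\<in>{n}. x ^ n / fact n) \<le> exp x"
    by (simp add: sums_iff)
  then show ?thesis
    by simp
qed

text \<open>Bound the binomial coefficient by \<open>(R * m) ^ m / fact m\<close>; the factor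
  \<open>m ^ m / fact m\<close> is one term of the series of \<open>exp m\<close>.\<close>

lemma binomial_mult_le:
  "real ((R * m) choose m) \<le> (exp 1 * R) ^ m"
proof -
  have "real ((R * m) choose m) * fact m = real (((R * m) choose m) * fact m)"
    by simp
  also have "\<dots> \<le> real ((R * m) ^ m)"
    using binomial_fact_pow of_nat_mono by blast
  finally have "real ((R * m) choose m) \<le> real R ^ m * (real m ^ m / fact m)"
    by (simp add: field_simps power_mult_distrib)
  also have "\<dots> \<le> real R ^ m * exp (real m)"
    by (intro mult_left_mono power_div_fact_le_exp) auto
  also have "exp (real m) = exp 1 ^ m"
    using exp_of_nat_mult[of m "1::real"] by simp
  finally show ?thesis
    by (simp add: power_mult_distrib mult.commute)
qed

lemma sum_power_le:
  fixes x :: real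
  assumes "0 \<le> x" "x \<le> 1 / 2"
  shows "(\<Sum>m\<in>{1..N}. x ^ m) \<le> 2 * x"
proof -
  \<comment> \<open>The extra term strengthens the induction hypothesis: it leaves room for the next
    power.\<close>
  have "(\<Sum>m\<in>{1..N}. x ^ m) + 2 * x ^ Suc N \<le> 2 * x"
  proof (induction N)
    case (Suc N)
    have "2 * x * x ^ Suc N \<le> 1 * x ^ Suc N"
      using assms by (intro mult_right_mono) auto
    with Suc show ?case
      by simp
  qed simp
  moreover have "0 \<le> x ^ Suc N"
    using assms by simp
  ultimately show ?thesis
    by linarith
qed

lemma prob_independent_random_subgraph:
  assumes G: "simple_graph G" and p: "0 \<le> p" "p \<le> 1"
  shows "measure_pmf.prob (random_subgraph G p) {X. \<forall>e\<in>edges X. \<not> e \<subseteq> K}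
    = (1 - p) ^ card {e \<in> edges G. e \<subseteq> K}"
proof -
  define B where "B e = (if e \<subseteq> K then {False} else UNIV)" for e
  have fin: "finite (edges G)"
    by (rule finite_edges[OF G])
  have "measure_pmf.prob (random_subgraph G p) {X. \<forall>e\<in>edges X. \<not> e \<subseteq> K}
      = measure_pmf.prob (Pi_pmf (edges G) False (\<lambda>_. bernoulli_pmf p)) (Pi (edges G) B)"
    unfolding random_subgraph_def measure_map_pmf
    by (intro arg_cong[where f = "measure_pmf.prob _"]) (auto simp: B_def Pi_def)
  also have "\<dots> = (\<Prod>e\<in>edges G. measure_pmf.prob (bernoulli_pmf p) (B e))"
    using fin by (rule measure_Pi_pmf_Pi)
  also have "\<dots> = (\<Prod>e\<in>edges G. if e \<subseteq> K then 1 - p else 1)"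
    using p by (intro prod.cong) (auto simp: B_def measure_pmf_single)
  also have "\<dots> = (1 - p) ^ card {e \<in> edges G. e \<subseteq> K}"
    using fin by (simp add: prod.If_cases Int_def)
  finally show ?thesis .
qed

lemma log_retention_pos:
  fixes p t :: real
  assumes "0 < p" "p < 1" "1 \<le> t"
  shows "0 < log (1 / (1 - p)) (2 * exp 1 * t)"
proof -
  have "2 * 1 \<le> exp 1 * t"
    using exp_ge_add_one_self[of 1] assms by (intro mult_mono) auto
  then have "1 < 2 * exp 1 * t" "1 < 1 / (1 - p)"
    using assms by auto
  then show ?thesis
    using assms by (intro iffD2[OF zero_less_log_cancel_iff]) auto
qed

lemma prob_heavy_independent_set:
  fixes G :: "'a ugraph" and w :: "'a \<Rightarrow> real" and p t :: real
  assumes G: "simple_graph G" and p: "0 < p" "p < 1"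
    and nonneg: "\<And>v. v \<in> verts G \<Longrightarrow> 0 \<le> w v"
    and indep: "\<And>I. I \<in> independent_sets G \<Longrightarrow> sum w I \<le> 1"
    and R: "0 < R" "sum w (verts G) \<le> real R" "real R \<le> t"
  defines "c \<equiv> log (1 / (1 - p)) (2 * exp 1 * t)"
  shows "measure_pmf.prob (random_subgraph G p)
      {X. \<exists>J\<subseteq>verts G. (\<forall>e\<in>edges X. \<not> e \<subseteq> J) \<and> 4 * c + 2 < sum w J} \<le> 1 / (2 * exp 1 * t)"
proof -
  define V where "V = verts G"
  have V: "finite V"
    using G by (simp add: V_def simple_graph_def)
  obtain \<rho> where rank: "bij_betw \<rho> V {..<card V}"
    and antimono: "\<And>u v. u \<in> V \<Longrightarrow> v \<in> V \<Longrightarrow> \<rho> u \<le> \<rho> v \<Longrightarrow> w v \<le> w u"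
    using rank_by_weight[OF V] by blast
  have t: "1 \<le> t"
    using R by linarith
  have e1: "2 \<le> exp (1::real)"
    using exp_ge_add_one_self[of 1] by simp
  have "2 * 1 \<le> exp 1 * t"
    using e1 t by (intro mult_mono) auto
  then have et: "1 < 2 * exp 1 * t"
    by simp
  have b: "1 < 1 / (1 - p)"
    using p by simp
  have c: "0 < c"
    unfolding c_def using p t by (rule log_retention_pos)
  \<comment> \<open>Rounding serves both sides: \<open>d \<le> 4 * c\<close> keeps the weight
    threshold at \<open>4 * c + 2\<close>, and \<open>d + 1 > 4 * c\<close> makes \<open>K\<close>
    span at least \<open>2 * c * card K\<close> edges.\<close>
  define d where "d = nat \<lfloor>4 * c\<rfloor>"
  have d: "real d \<le> 4 * c" "4 * c < real d + 1"
    using c by (auto simp: d_def)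
  \<comment> \<open>This is \<open>(1 - p)\<close> to the power \<open>2 * c\<close>, the price per
    vertex of \<open>K\<close>. Below, \<open>x\<close> is \<open>exp 1 * t * q\<close>: price times
    the number of choices per vertex.\<close>
  define q where "q = 1 / (2 * exp 1 * t)\<^sup>2"
  define x where "x = 1 / (4 * exp 1 * t)"
  define \<K> where "\<K> = {K. K \<subseteq> V \<and> K \<noteq> {} \<and> (\<forall>v\<in>K. \<rho> v < R * card K) \<and>
    (d + 1) * card K \<le> 2 * card {e \<in> edges G. e \<subseteq> K}}"
  have fin: "finite \<K>"
    using V by (auto simp: \<K>_def intro: finite_subset[of _ "Pow V"])
  have prob_K: "measure_pmf.prob (random_subgraph G p) {X. \<forall>e\<in>edges X. \<not> e \<subseteq> K} \<le> q ^ card K"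
    if "K \<in> \<K>" for K
  proof -
    define m where "m = card {e \<in> edges G. e \<subseteq> K}"
    have "real ((d + 1) * card K) \<le> real (2 * m)"
      using that unfolding \<K>_def m_def by (intro of_nat_mono) blast
    then have "(real d + 1) * card K \<le> 2 * m"
      by (simp add: algebra_simps)
    moreover have "4 * c * card K \<le> (real d + 1) * card K"
      using d by (intro mult_right_mono) auto
    ultimately have m: "c * real (2 * card K) \<le> real m"
      by simp
    have "(2 * exp 1 * t) ^ (2 * card K) = (2 * exp 1 * t) powr real (2 * card K)"
      using et by (intro powr_realpow[symmetric]) linarith
    \<comment> \<open>The choice of \<open>c\<close> is exactly that \<open>1 / (1 - p)\<close> to
      the power \<open>c\<close> equals \<open>2 * exp 1 * t\<close>.\<close>
    also have "\<dots> = ((1 / (1 - p)) powr c) powr real (2 * card K)"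
      unfolding c_def using p t by (subst powr_log_cancel) auto
    also have "\<dots> \<le> (1 / (1 - p)) powr real m"
      unfolding powr_powr using b m by (intro powr_mono) linarith+
    also have "\<dots> = (1 / (1 - p)) ^ m"
      using b by (intro powr_realpow) linarith
    finally have "1 / (1 / (1 - p)) ^ m \<le> 1 / (2 * exp 1 * t) ^ (2 * card K)"
      using p t by (intro divide_left_mono mult_pos_pos zero_less_power) auto
    then have "(1 - p) ^ m \<le> q ^ card K"
      by (simp add: q_def power_divide power_mult)
    then show ?thesis
      using prob_independent_random_subgraph[OF G, of p K] p by (simp add: m_def)
  qed
  have "measure_pmf.prob (random_subgraph G p)
      {X. \<exists>J\<subseteq>V. (\<forall>e\<in>edges X. \<not> e \<subseteq> J) \<and> 4 * c + 2 < sum w J}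
    \<le> measure_pmf.prob (random_subgraph G p) (\<Union>K\<in>\<K>. {X. \<forall>e\<in>edges X. \<not> e \<subseteq> K})"
  proof (rule measure_pmf.finite_measure_mono)
    show "{X :: 'a ugraph. \<exists>J\<subseteq>V. (\<forall>e\<in>edges X. \<not> e \<subseteq> J) \<and> 4 * c + 2 < sum w J}
      \<subseteq> (\<Union>K\<in>\<K>. {X. \<forall>e\<in>edges X. \<not> e \<subseteq> K})"
    proof
      fix X :: "'a ugraph"
      assume "X \<in> {X. \<exists>J\<subseteq>V. (\<forall>e\<in>edges X. \<not> e \<subseteq> J) \<and> 4 * c + 2 < sum w J}"
      then obtain J where J: "J \<subseteq> V" "\<forall>e\<in>edges X. \<not> e \<subseteq> J" "4 * c + 2 < sum w J"
        by blast
      have "sum w V / R \<le> 1"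
        using R by (simp add: V_def)
      then have "d + 1 + sum w V / R < sum w J"
        using J(3) d by linarith
      then have "\<exists>K\<subseteq>J. K \<noteq> {} \<and> (\<forall>v\<in>K. \<rho> v < R * card K) \<and>
          (d + 1) * card K \<le> 2 * card {e \<in> edges G. e \<subseteq> K}"
        using J(1) by (intro dense_subset_of_heavy_set[OF G rank[unfolded V_def] antimono[unfolded V_def]
          nonneg indep \<open>0 < R\<close>]) (auto simp: V_def)
      then obtain K where K: "K \<subseteq> J" "K \<in> \<K>"
        using J(1) unfolding \<K>_def by blast
      then have "\<forall>e\<in>edges X. \<not> e \<subseteq> K"
        using J(2) by blast
      with K show "X \<in> (\<Union>K\<in>\<K>. {X. \<forall>e\<in>edges X. \<not> e \<subseteq> K})"
        by blast
    qed
  qed simp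
  also have "\<dots> \<le> (\<Sum>K\<in>\<K>. measure_pmf.prob (random_subgraph G p) {X. \<forall>e\<in>edges X. \<not> e \<subseteq> K})"
    using fin by (intro measure_pmf.finite_measure_subadditive_finite) auto
  also have "\<dots> \<le> (\<Sum>K\<in>\<K>. q ^ card K)"
    by (intro sum_mono prob_K)
  also have "\<dots> = (\<Sum>m\<in>{1..card V}. \<Sum>K\<in>{K \<in> \<K>. card K = m}. q ^ card K)"
  proof (rule sum.group[symmetric])
    show "card ` \<K> \<subseteq> {1..card V}"
    proof
      fix m assume "m \<in> card ` \<K>"
      then obtain K where K: "m = card K" "K \<subseteq> V" "K \<noteq> {}"
        by (auto simp: \<K>_def)
      then have "card K \<noteq> 0" "card K \<le> card V"
        using V finite_subset[of K V] card_mono[of V K] by auto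
      then show "m \<in> {1..card V}"
        using K(1) by simp
    qed
  qed (use fin in auto)
  also have "\<dots> \<le> (\<Sum>m\<in>{1..card V}. x ^ m)"
  proof (rule sum_mono)
    fix m
    define U where "U = {v \<in> V. \<rho> v < R * m}"
    have "finite U"
      using V by (simp add: U_def)
    \<comment> \<open>Members of \<open>\<K>\<close> of size \<open>m\<close> lie in
      \<open>U\<close>, and ranks are injective, so they are among the \<open>m\<close>-subsets of
      at most \<open>R * m\<close> vertices.\<close>
    have "card U \<le> card {..<R * m}"
      using rank by (intro card_inj_on_le[of \<rho>]) (auto simp: U_def bij_betw_def inj_on_def)
    then have "card U choose m \<le> (R * m) choose m"
      by (intro binomial_right_mono) simp
    have "card {K \<in> \<K>. card K = m} \<le> card {K. K \<subseteq> U \<and> card K = m}"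
      using \<open>finite U\<close> by (intro card_mono) (auto simp: \<K>_def U_def)
    also have "\<dots> = card U choose m"
      using \<open>finite U\<close> by (rule n_subsets)
    also have "\<dots> \<le> (R * m) choose m"
      by fact
    finally have "real (card {K \<in> \<K>. card K = m}) \<le> real ((R * m) choose m)"
      by simp
    also have "\<dots> \<le> (exp 1 * R) ^ m"
      by (rule binomial_mult_le)
    also have "\<dots> \<le> (exp 1 * t) ^ m"
      using R by (intro power_mono mult_left_mono) auto
    finally have "real (card {K \<in> \<K>. card K = m}) * q ^ m \<le> (exp 1 * t) ^ m * q ^ m"
      by (intro mult_right_mono) (auto simp: q_def)
    also have "\<dots> = x ^ m"
      using t by (simp add: q_def x_def power2_eq_square mult.assoc flip: power_mult_distrib)
    finally show "(\<Sum>K\<in>{K \<in> \<K>. card K = m}. q ^ card K) \<le> x ^ m"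
      by simp
  qed
  also have "\<dots> \<le> 2 * x"
    using et by (intro sum_power_le) (auto simp: x_def field_simps)
  finally show ?thesis
    by (simp add: x_def V_def ac_simps)
qed

section \<open>Passing to a subgraph of large girth\<close>

lemma random_subgraph_support:
  assumes "simple_graph G" "X \<in> set_pmf (random_subgraph G p)"
  shows "subgraph X G" "verts X = verts G"
  using assms by (fastforce simp: random_subgraph_def subgraph_def simple_graph_def)+

lemma h_frac_ge:
  assumes "simple_graph G" "subgraph H G" "enat r \<le> girth H"
  shows "frac_chromatic H \<le> h_frac r G"
  unfolding h_frac_def
proof (rule Max_ge)
  have "{frac_chromatic H |H. subgraph H G \<and> enat r \<le> girth H} \<subseteq> frac_chromatic ` {H. subgraph H G}"
    by blast
  then show "finite {frac_chromatic H |H. subgraph H G \<and> enat r \<le> girth H}"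
    using finite_subgraphs[OF assms(1)] finite_surj by blast
qed (use assms in blast)

lemma finite_short_cycles:
  assumes "simple_graph X"
  shows "finite (short_cycles r X)"
  using finite_subgraphs[OF assms]
  by (rule rev_finite_subset) (auto simp: short_cycles_def cycles_def)

text \<open>Apply \<open>hypergraph_coloring\<close> to the vertex sets of short cycles. A short
  cycle inside a colour class would be monochromatic, and by averaging some class has at least the
  mean weight.\<close>

lemma high_girth_class:
  fixes w :: "'a \<Rightarrow> real"
  assumes X: "simple_graph X"
    and few: "\<And>v. v \<in> verts X \<Longrightarrow> card {C \<in> short_cycles r X. v \<in> verts C} \<le> k"
  obtains U where "U \<subseteq> verts X" "sum w (verts X) / (k + 1) \<le> sum w U"
    "enat r \<le> girth \<lparr>verts = U, edges = {e \<in> edges X. e \<subseteq> U}\<rparr>"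
proof -
  have V: "finite (verts X)"
    using X by (simp add: simple_graph_def)
  have "\<exists>f::'a \<Rightarrow> nat. (\<forall>v. f v \<le> k) \<and>
    (\<forall>e\<in>verts ` short_cycles r X. e \<subseteq> verts X \<longrightarrow> \<not> (\<exists>c. f ` e \<subseteq> {c}))"
  proof (rule hypergraph_coloring[OF V])
    fix e v assume "e \<in> verts ` short_cycles r X"
    then have "3 \<le> card e"
      by (auto simp: short_cycles_def)
    then show "\<not> e \<subseteq> {v}"
      using card_mono[of "{v}" e] by auto
  next
    fix v assume v: "v \<in> verts X"
    have eq: "{e \<in> verts ` short_cycles r X. v \<in> e} = verts ` {C \<in> short_cycles r X. v \<in> verts C}"
      by auto
    have "finite {C \<in> short_cycles r X. v \<in> verts C}"
      using finite_short_cycles[OF X] by simp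
    then show "finite {e \<in> verts ` short_cycles r X. v \<in> e} \<and>
        card {e \<in> verts ` short_cycles r X. v \<in> e} \<le> k"
      unfolding eq using card_image_le few[OF v] le_trans by blast
  qed
  then obtain f :: "'a \<Rightarrow> nat" where f: "\<forall>v. f v \<le> k"
    "\<forall>e\<in>verts ` short_cycles r X. e \<subseteq> verts X \<longrightarrow> \<not> (\<exists>c. f ` e \<subseteq> {c})"
    by (elim exE conjE) (rule that)
  have not_monochromatic: False
    if "C \<in> short_cycles r X" "verts C \<subseteq> verts X" "f ` verts C \<subseteq> {c}" for C c
  proof -
    have "\<not> (\<exists>c. f ` verts C \<subseteq> {c})"
      using f(2) that(1,2) by simp
    then show False
      using that(3) by simp
  qed
  define U where "U c = {v \<in> verts X. f v = c}" for c
  have total: "sum w (verts X) = (\<Sum>c\<in>{..k}. sum w (U c))"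
    unfolding U_def using f(1) V by (intro sum.group[symmetric]) auto
  have "\<exists>c\<in>{..k}. sum w (verts X) / (k + 1) \<le> sum w (U c)"
  proof (rule ccontr)
    assume "\<not> ?thesis"
    then have "(\<Sum>c\<in>{..k}. sum w (U c)) < (\<Sum>c\<in>{..k}. sum w (verts X) / (k + 1))"
      by (intro sum_strict_mono) (auto simp: not_le)
    then show False
      using total by simp
  qed
  then obtain c where c: "sum w (verts X) / (k + 1) \<le> sum w (U c)"
    by blast
  let ?H = "\<lparr>verts = U c, edges = {e \<in> edges X. e \<subseteq> U c}\<rparr>"
  have "enat r \<le> girth ?H"
    unfolding girth_def
  proof (rule INF_greatest)
    fix C assume C: "C \<in> cycles ?H"
    then obtain vs where vs: "distinct vs" "3 \<le> length vs" "C = cycle_graph vs"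
      and sub: "subgraph C ?H"
      by (auto simp: cycles_def)
    have "verts C \<subseteq> U c" "subgraph C X"
      using sub by (auto simp: subgraph_def U_def)
    moreover have "3 \<le> card (verts C)"
      using vs by (simp add: cycle_graph_def distinct_card)
    ultimately have "C \<in> short_cycles r X" if "card (verts C) < r"
      using vs that by (auto simp: short_cycles_def cycles_def)
    moreover have "f ` verts C \<subseteq> {c}" "verts C \<subseteq> verts X"
      using \<open>verts C \<subseteq> U c\<close> by (auto simp: U_def)
    ultimately show "enat r \<le> enat (card (verts C))"
      using not_monochromatic[of C c] by (auto simp flip: not_less)
  qed
  moreover have "U c \<subseteq> verts X"
    by (auto simp: U_def)
  ultimately show thesis
    using c that by blast
qed

text \<open>Common core of both claims: \<open>S\<close> is any sufficiently likely event that
  forces at most \<open>k\<close> short cycles through each vertex.\<close>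

lemma h_frac_ge_of_few_short_cycles:
  fixes G :: "'a ugraph" and t p :: real
  assumes G: "simple_graph G" and t: "t = frac_chromatic G" "2 \<le> t" and p: "0 < p" "p < 1"
    and likely: "1 / (2 * t) < measure_pmf.prob (random_subgraph G p) S"
    and few: "\<And>X v. X \<in> S \<Longrightarrow> subgraph X G \<Longrightarrow> verts X = verts G \<Longrightarrow> v \<in> verts X
      \<Longrightarrow> card {C \<in> short_cycles r X. v \<in> verts C} \<le> k"
  shows "t / ((real k + 1) * (8 * log (1 / (1 - p)) (2 * exp 1 * t) + 4)) \<le> h_frac r G"
proof -
  define c where "c = log (1 / (1 - p)) (2 * exp 1 * t)"
  have c: "0 < c"
    unfolding c_def using p t by (intro log_retention_pos) auto
  \<comment> \<open>Duality needs a total strictly below \<open>t\<close>; taking half of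
    \<open>t\<close> turns the threshold \<open>4 * c + 2\<close> into the \<open>8 * c + 4\<close>
    of the conclusion.\<close>
  obtain w where w: "\<And>v. 0 \<le> w v" "sum w (verts G) = t / 2"
    "\<And>I. I \<in> independent_sets G \<Longrightarrow> sum w I \<le> 1"
    using fractional_clique_exists[OF G, of "t / 2"] t by auto
  define heavy where
    "heavy = {X :: 'a ugraph. \<exists>J\<subseteq>verts G. (\<forall>e\<in>edges X. \<not> e \<subseteq> J) \<and> 4 * c + 2 < sum w J}"
  have "measure_pmf.prob (random_subgraph G p) heavy \<le> 1 / (2 * exp 1 * t)"
    unfolding heavy_def c_def
  proof (rule prob_heavy_independent_set[OF G p])
    \<comment> \<open>The integer \<open>R\<close> must lie between the total weight
      \<open>t / 2\<close> and \<open>t\<close>; the floor does since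
      \<open>2 \<le> t\<close>.\<close>
    show "0 < nat \<lfloor>t\<rfloor>" "real (nat \<lfloor>t\<rfloor>) \<le> t" "sum w (verts G) \<le> real (nat \<lfloor>t\<rfloor>)"
      using t(2) w(2) by linarith+
  qed (use w in auto)
  also have "\<dots> \<le> 1 / (2 * t)"
    using t by (intro divide_left_mono) auto
  also have "\<dots> < measure_pmf.prob (random_subgraph G p) S"
    by (rule likely)
  finally have less: "measure_pmf.prob (random_subgraph G p) heavy
    < measure_pmf.prob (random_subgraph G p) S" .
  \<comment> \<open>\<open>S\<close> is likelier than \<open>heavy\<close>, so it is not contained
    in it on the support.\<close>
  have "\<exists>X\<in>set_pmf (random_subgraph G p). X \<in> S \<and> X \<notin> heavy"
  proof (rule ccontr)
    assume "\<not> ?thesis"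
    then have "measure_pmf.prob (random_subgraph G p) S
        \<le> measure_pmf.prob (random_subgraph G p) heavy"
      by (intro measure_pmf.finite_measure_mono_AE) (auto simp: AE_measure_pmf_iff)
    with less show False
      by simp
  qed
  then obtain X where X: "subgraph X G" "verts X = verts G" "X \<in> S" "X \<notin> heavy"
    using random_subgraph_support[OF G] by blast
  then have "simple_graph X"
    by (simp add: subgraph_def)
  then obtain U where U: "U \<subseteq> verts X" "sum w (verts X) / (k + 1) \<le> sum w U"
    "enat r \<le> girth \<lparr>verts = U, edges = {e \<in> edges X. e \<subseteq> U}\<rparr>"
    using high_girth_class[of X r k w] few X by blast
  let ?H = "\<lparr>verts = U, edges = {e \<in> edges X. e \<subseteq> U}\<rparr>"
  have H: "subgraph ?H G" "simple_graph ?H"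
    using U(1) X(1) finite_subset[of U "verts X"] by (auto simp: subgraph_def simple_graph_def)
  have "sum w I \<le> 4 * c + 2" if "I \<in> independent_sets ?H" for I
  proof -
    have "I \<subseteq> U" and I: "\<forall>e\<in>edges X. e \<subseteq> U \<longrightarrow> \<not> e \<subseteq> I"
      using that by (auto simp: independent_sets_def)
    \<comment> \<open>The subgraph is induced on \<open>U\<close>, so its independent sets are
      independent in all of \<open>X\<close>.\<close>
    then have "I \<subseteq> verts G" "\<forall>e\<in>edges X. \<not> e \<subseteq> I"
      using U(1) X(2) by blast+
    then show ?thesis
      using X(4) by (auto simp: heavy_def not_less)
  qed
  then have "sum w U / (4 * c + 2) \<le> frac_chromatic ?H"
    using frac_chromatic_ge_weight[OF H(2), of "4 * c + 2" w] w(1) c by simp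
  moreover have "frac_chromatic ?H \<le> h_frac r G"
    using G H(1) U(3) by (rule h_frac_ge)
  moreover have "t / 2 / (k + 1) / (4 * c + 2) \<le> sum w U / (4 * c + 2)"
    using U(2) X(2) w(2) c by (intro divide_right_mono) auto
  moreover have "t / 2 / (k + 1) / (4 * c + 2) = t / ((real k + 1) * (8 * c + 4))"
    using c by (simp add: field_simps)
  ultimately show ?thesis
    unfolding c_def by linarith
qed

theorem proposition9p13:
  fixes G :: "'a ugraph" and r :: nat and t p :: real
  assumes "4 \<le> r"
    and "simple_graph G"
    and "t = frac_chromatic G" and "2 \<le> t"
    and "0 < p" and "p < 1"
  shows "(\<forall>D::real. 0 \<le> D \<longrightarrow>
      measure_pmf.prob (random_subgraph G p) {X. real (max_short_cycles r X) \<le> D} > 1 / (2 * t) \<longrightarrow>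
      h_frac r G \<ge> t / ((D + 1) * (8 * log (1 / (1 - p)) (2 * exp 1 * t) + 4)))
    \<and> (measure_pmf.prob (random_subgraph G p)
        {X. pairwise (\<lambda>C C'. disjnt (verts C) (verts C')) (short_cycles r X)} > 1 / (2 * t) \<longrightarrow>
      h_frac r G \<ge> t / (2 * (8 * log (1 / (1 - p)) (2 * exp 1 * t) + 4)))"
proof (intro conjI allI impI)
  let ?c = "log (1 / (1 - p)) (2 * exp 1 * t)"
  have c: "0 < ?c"
    using assms(4-6) by (intro log_retention_pos) auto
  {
    fix D :: real
    assume D: "0 \<le> D" and likely: "1 / (2 * t)
      < measure_pmf.prob (random_subgraph G p) {X. real (max_short_cycles r X) \<le> D}"
    \<comment> \<open>Cycle counts are integers, so the real bound \<open>D\<close> may be rounded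
      down, which only strengthens the estimate.\<close>
    have "t / ((real (nat \<lfloor>D\<rfloor>) + 1) * (8 * ?c + 4)) \<le> h_frac r G"
    proof (rule h_frac_ge_of_few_short_cycles[OF assms(2-6) likely])
      fix X v
      assume X: "X \<in> {X. real (max_short_cycles r X) \<le> D}" "subgraph X G" and v: "v \<in> verts X"
      have "card {C \<in> short_cycles r X. v \<in> verts C} \<le> max_short_cycles r X"
        unfolding max_short_cycles_def
        using X(2) v by (intro Max_ge) (auto simp: subgraph_def simple_graph_def)
      then show "card {C \<in> short_cycles r X. v \<in> verts C} \<le> nat \<lfloor>D\<rfloor>"
        using X(1) by (intro le_nat_floor) simp
    qed
    moreover have "t / ((D + 1) * (8 * ?c + 4)) \<le> t / ((real (nat \<lfloor>D\<rfloor>) + 1) * (8 * ?c + 4))"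
      using D c \<open>2 \<le> t\<close>
      by (intro divide_left_mono mult_right_mono mult_pos_pos) linarith+
    ultimately show "t / ((D + 1) * (8 * ?c + 4)) \<le> h_frac r G"
      by linarith
  }
  assume likely: "1 / (2 * t) < measure_pmf.prob (random_subgraph G p)
    {X. pairwise (\<lambda>C C'. disjnt (verts C) (verts C')) (short_cycles r X)}"
  \<comment> \<open>Disjointness allows at most one short cycle through a vertex, so two colours
    suffice.\<close>
  have "t / ((real 1 + 1) * (8 * ?c + 4)) \<le> h_frac r G"
  proof (rule h_frac_ge_of_few_short_cycles[OF assms(2-6) likely])
    fix X :: "'a ugraph" and v
    assume "X \<in> {X. pairwise (\<lambda>C C'. disjnt (verts C) (verts C')) (short_cycles r X)}"
      and "subgraph X G"
    then have "C = C'" if "C \<in> short_cycles r X" "C' \<in> short_cycles r X" "v \<in> verts C" "v \<in> verts C'"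
      for C C'
      using that by (auto simp: pairwise_def disjnt_def)
    moreover have "finite {C \<in> short_cycles r X. v \<in> verts C}"
      using finite_short_cycles[of X r] \<open>subgraph X G\<close> by (simp add: subgraph_def)
    ultimately show "card {C \<in> short_cycles r X. v \<in> verts C} \<le> 1"
      by (auto simp: card_le_Suc0_iff_eq)
  qed
  then show "t / (2 * (8 * ?c + 4)) \<le> h_frac r G"
    by simp
qed

end
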